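(* For $n\geqslant1$ let $\widehat{P}_n(x)=\sum_{\pi\in\mathfrak{S}_n}x^{\mathrm{lpk}(\pi)}$ be the left peak polynomial. Then for every $n\geqslant1$, $$\widehat{P}_{2n}(x)=\sum_{j=0}^{n}(2j)!\,V(n,j)\,x^j(1-x)^{n-j},\qquad \widehat{P}_{2n+1}(x)=\sum_{j=0}^{n}(2j+1)!\,V(n,j)\,x^j(1-x)^{n-j}.$$
   Context: $\mathfrak{S}_n$ is the symmetric group on $[n]$. For $\pi=\pi(1)\cdots\pi(n)\in\mathfrak{S}_n$, with the convention $\pi(0)=0$, a left peak is an index $i\in[n-1]$ with $\pi(i-1)<\pi(i)>\pi(i+1)$, and $\mathrm{lpk}(\pi)$ is the number of left peaks. The central factorial numbers of odd indices $V(n,k)$ ($n,k\geqslant0$) are defined by $V(0,0)=1$, $V(0,k)=0$ for $k\neq0$, and $V(n,k)=V(n-1,k-1)+(2k+1)^2V(n-1,k)$ (with $V(n,-1)=0$); equivalently $V(n,k)=4^{n-k}T(2n+1,2k+1)$ where $T$ are Riordan's central factorial numbers of the second kind. *)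

theory Defs
  imports
    "HOL-Computational_Algebra.Polynomial"
    "HOL-Combinatorics.Permutations"
begin

text \<open>
  Permutations of \<open>[n]\<close> are functions \<open>\<pi> :: nat \<Rightarrow> nat\<close> with \<open>\<pi> permutes {1..n}\<close>. Such a function
  fixes everything outside \<open>{1..n}\<close>, so the convention \<open>\<pi> 0 = 0\<close> holds automatically.
\<close>

definition left_peaks :: "nat \<Rightarrow> (nat \<Rightarrow> nat) \<Rightarrow> nat set" where
  "left_peaks n \<pi> = {i \<in> {1..n - 1}. \<pi> (i - 1) < \<pi> i \<and> \<pi> i > \<pi> (i + 1)}"

definition lpk :: "nat \<Rightarrow> (nat \<Rightarrow> nat) \<Rightarrow> nat" where
  "lpk n \<pi> = card (left_peaks n \<pi>)"

definition left_peak_poly :: "nat \<Rightarrow> int poly" where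
  "left_peak_poly n = (\<Sum>\<pi> | \<pi> permutes {1..n}. [:0, 1:] ^ lpk n \<pi>)"

text \<open>
  Central factorial numbers of odd indices. The \<open>if\<close> in the second equation is the
  convention \<open>V(n, -1) = 0\<close>.
\<close>

fun central_fact_odd :: "nat \<Rightarrow> nat \<Rightarrow> nat" where
  "central_fact_odd 0 k = (if k = 0 then 1 else 0)"
| "central_fact_odd (Suc n) k =
     (if k = 0 then 0 else central_fact_odd n (k - 1)) + (2 * k + 1)\<^sup>2 * central_fact_odd n k"

end

theory Submission
  imports Defs
begin

text \<open>
  Inserting the letter \<open>n + 1\<close> into a permutation of \<open>[n]\<close> with \<open>k\<close> left peaks leaves the number of
  left peaks unchanged in \<open>2k + 1\<close> slots (at the end, or next to a peak) and raises it by one in the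
  other \<open>n - 2k\<close> slots. Hence the left peak polynomials satisfy
  \<open>P\<^bsub>n+1\<^esub> = (1 + n x) P\<^bsub>n\<^esub> + 2 x (1 - x) P'\<^bsub>n\<^esub>\<close>.
  This operator multiplies \<open>x\<^sup>j (1 - x)\<^bsup>m-j\<^esup>\<close> by \<open>2j + 1\<close> if \<open>n = 2m\<close>, and by
  \<open>2j + 1 + x = (2j + 1) (1 - x) + (2j + 2) x\<close> if \<open>n = 2m + 1\<close>, which yields the recurrence
  of \<open>V(n, k)\<close>.
\<close>

section \<open>Insertion of the largest letter as a bijection\<close>

text \<open>
  If \<open>\<pi>\<close> permutes \<open>{1..n - 1}\<close>, then \<open>\<pi> \<circ> slot_cycle n p\<close> is \<open>\<pi>\<close> with the letter \<open>n\<close> inserted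
  at position \<open>p\<close>.
\<close>

definition slot_cycle :: "nat \<Rightarrow> nat \<Rightarrow> nat \<Rightarrow> nat" where
  "slot_cycle n p i = (if i < p \<or> n < i then i else if i = p then n else i - 1)"

lemma slot_cycle_permutes:
  assumes "p \<in> {1..n}"
  shows "slot_cycle n p permutes {1..n}"
proof (rule inj_imp_permutes)
  show "inj_on (slot_cycle n p) {1..n}"
    by (auto simp: inj_on_def slot_cycle_def split: if_splits)
qed (use assms in \<open>auto simp: slot_cycle_def split: if_splits\<close>)

lemma slot_cycle_eq_last_iff:
  assumes "p \<in> {1..n}"
  shows "slot_cycle n p i = n \<longleftrightarrow> i = p"
  using assms by (auto simp: slot_cycle_def)

text \<open>The slot is recovered as the position of the largest letter, after which the cycle
  cancels on the right. Surjectivity is a count: \<open>n! * (n + 1) = (n + 1)!\<close>.\<close>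

lemma permutes_Suc_bij_betw:
  "bij_betw (\<lambda>(\<pi>, p). \<pi> \<circ> slot_cycle (Suc n) p)
     ({\<pi>. \<pi> permutes {1..n}} \<times> {1..Suc n}) {\<sigma>. \<sigma> permutes {1..Suc n}}"
    (is "bij_betw ?f ?A ?B")
proof -
  have perm: "\<pi> permutes {1..Suc n}" if "\<pi> permutes {1..n}" for \<pi>
    using that by (rule permutes_subset) auto
  have fix_last: "\<pi> i = Suc n \<longleftrightarrow> i = Suc n" if "\<pi> permutes {1..n}" for \<pi> i
    using permutes_not_in[OF that, of "Suc n"] inj_eq[OF permutes_inj[OF that], of i "Suc n"] by simp
  have inj: "inj_on ?f ?A"
  proof (intro inj_onI, clarify)
    fix \<pi> p \<pi>' q
    assume \<pi>: "\<pi> permutes {1..n}" and \<pi>': "\<pi>' permutes {1..n}"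
      and p: "p \<in> {1..Suc n}" and q: "q \<in> {1..Suc n}"
      and eq: "\<pi> \<circ> slot_cycle (Suc n) p = \<pi>' \<circ> slot_cycle (Suc n) q"
    have "\<pi>' (slot_cycle (Suc n) q p) = \<pi> (slot_cycle (Suc n) p p)"
      using fun_cong[OF eq, of p] by simp
    also have "\<dots> = Suc n"
      using fix_last[OF \<pi>] slot_cycle_eq_last_iff[OF p] by simp
    finally have [simp]: "q = p"
      using fix_last[OF \<pi>'] slot_cycle_eq_last_iff[OF q] by simp
    have "surj (slot_cycle (Suc n) p)"
      using slot_cycle_permutes[OF p] by (rule permutes_surj)
    then have "\<pi> = \<pi>'"
      using eq by (metis \<open>q = p\<close> fun.map_comp surj_iff comp_id comp_assoc)
    then show "\<pi> = \<pi>' \<and> p = q" by simp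
  qed
  moreover have "?f ` ?A = ?B"
  proof (rule card_subset_eq)
    show "finite ?B" by (simp add: finite_permutations)
    show "?f ` ?A \<subseteq> ?B"
      by (auto simp del: One_nat_def atLeastAtMost_iff intro: permutes_compose slot_cycle_permutes perm)
    have "card (?f ` ?A) = card ?A"
      by (rule card_image[OF inj])
    also have "\<dots> = fact n * Suc n"
      using card_permutations[of "{1..n}" n] by (simp add: card_cartesian_product)
    also have "\<dots> = card ?B"
      using card_permutations[of "{1..Suc n}" "Suc n"] by (simp add: algebra_simps)
    finally show "card (?f ` ?A) = card ?B" .
  qed
  ultimately show ?thesis by (simp add: bij_betw_def)
qed

section \<open>Left peaks under insertion\<close>

lemma finite_left_peaks [simp]: "finite (left_peaks n \<pi>)"
  by (simp add: left_peaks_def)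

lemma Suc_notin_left_peaks: "i \<in> left_peaks n \<pi> \<Longrightarrow> Suc i \<notin> left_peaks n \<pi>"
  by (auto simp: left_peaks_def)

text \<open>A letter inserted at \<open>p\<close> lands just before the old \<open>p\<close>-th
  letter, so the slots beside a peak \<open>i\<close> are \<open>i\<close> and \<open>i + 1\<close>.
  Peaks are never adjacent, hence no slot is counted twice.\<close>

lemma card_left_peaks_Un_Suc:
  "card (left_peaks n \<pi> \<union> Suc ` left_peaks n \<pi>) = 2 * lpk n \<pi>"
proof -
  have "left_peaks n \<pi> \<inter> Suc ` left_peaks n \<pi> = {}"
    using Suc_notin_left_peaks by auto
  then show ?thesis
    by (simp add: card_Un_disjoint card_image lpk_def)
qed

lemma left_peaks_Un_Suc_subset: "left_peaks n \<pi> \<union> Suc ` left_peaks n \<pi> \<subseteq> {1..n}"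
  by (auto simp: left_peaks_def)

text \<open>The new letter is the maximum: it destroys peaks at its neighbours, the old positions
  \<open>p - 1\<close> and \<open>p\<close>, and is itself a peak unless it comes last. Peaks
  further left stay; those further right move by one.\<close>

lemma left_peaks_insert:
  assumes \<pi>: "\<pi> permutes {1..n}" and p: "p \<in> {1..Suc n}"
  shows "left_peaks (Suc n) (\<pi> \<circ> slot_cycle (Suc n) p) =
           {i \<in> left_peaks n \<pi>. i < p - 1} \<union> ({p} \<inter> {..n}) \<union> Suc ` {i \<in> left_peaks n \<pi>. p < i}"
    (is "?L = ?R")
proof -
  define \<sigma> where "\<sigma> = \<pi> \<circ> slot_cycle (Suc n) p"
  have fix_last: "\<pi> (Suc n) = Suc n"
    using \<pi> by (simp add: permutes_not_in)
  \<comment> \<open>Index 0 is included: \<open>\<pi> 0 = 0\<close> makes the new letter exceed its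
    left neighbour even when \<open>p = 1\<close>.\<close>
  have le: "\<pi> i \<le> n" if "i \<le> n" for i
    using that permutes_in_image[OF \<pi>, of i] permutes_not_in[OF \<pi>, of i]
    by (cases "i \<in> {1..n}") auto
  have below: "\<sigma> i = \<pi> i" if "i < p" for i
    using that by (simp add: \<sigma>_def slot_cycle_def)
  have at: "\<sigma> p = Suc n"
    using p fix_last by (simp add: \<sigma>_def slot_cycle_def)
  have above: "\<sigma> (Suc i) = \<pi> i" if "p \<le> i" "i \<le> n" for i
    using that by (simp add: \<sigma>_def slot_cycle_def)
  have le_\<sigma>: "\<sigma> i \<le> Suc n" if "i \<le> Suc n" for i
  proof -
    consider "i < p" | "i = p" | j where "i = Suc j" "p \<le> j" "j \<le> n"
      using \<open>i \<le> Suc n\<close> by (cases i) (auto simp: not_less_eq, linarith)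
    then show ?thesis
    proof cases
      case 1
      then show ?thesis using p below[of i] le[of i] by simp
    qed (use at above le le_Suc_eq in auto)
  qed
  have "i \<in> left_peaks (Suc n) \<sigma> \<longleftrightarrow> i \<in> ?R" for i
  proof -
    \<comment> \<open>Only in the first and last case do \<open>i - 1\<close>, \<open>i\<close>,
      \<open>i + 1\<close> all avoid \<open>p\<close>, so that the comparison reduces to one in
      \<open>\<pi>\<close>.\<close>
    consider "i < p - 1" | "i = p - 1" "i < p" | "i = p" | "i = Suc p" | "Suc p < i"
      using p by force
    then show ?thesis
    proof cases
      case 1
      then have "i \<le> n - 1" "i - 1 < p" "i + 1 < p" using p by auto
      then show ?thesis
        using 1 below[of i] below[of "i - 1"] below[of "i + 1"]
        by (auto simp: left_peaks_def)
    next
      case 2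
      then have "\<sigma> (i + 1) = Suc n" using at p by simp
      then have "i \<notin> left_peaks (Suc n) \<sigma>"
        using le_\<sigma>[of i] p 2 by (auto simp: left_peaks_def)
      then show ?thesis using 2 by auto
    next
      case 3
      have "\<sigma> (p - 1) < Suc n"
        using below[of "p - 1"] le[of "p - 1"] p by (auto simp: less_Suc_eq_le)
      moreover have "\<sigma> (p + 1) < Suc n" if "p \<le> n"
        using above[of p] le[of p] that by simp
      ultimately show ?thesis
        using 3 p at by (auto simp: left_peaks_def)
    next
      case 4
      have "i \<notin> left_peaks (Suc n) \<sigma>"
        using 4 at le_\<sigma>[of i] by (auto simp: left_peaks_def)
      then show ?thesis using 4 by auto
    next
      case 5
      then obtain j where j: "i = Suc (Suc j)" "p \<le> j"
        by (metis Suc_less_eq2 less_imp_Suc_add less_Suc_eq_le)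
      have "i \<in> left_peaks (Suc n) \<sigma> \<longleftrightarrow> Suc j \<in> left_peaks n \<pi>"
        using j p above[of j] above[of "Suc j"] above[of "Suc (Suc j)"]
        by (auto simp: left_peaks_def)
      then show ?thesis using j by auto
    qed
  qed
  then show ?thesis unfolding \<sigma>_def by blast
qed

text \<open>At most one of the adjacent indices \<open>p - 1\<close>, \<open>p\<close> is a peak. If
  one is, its loss offsets the gain at \<open>p\<close>; in the last slot nothing is lost or
  gained.\<close>

lemma lpk_insert:
  assumes \<pi>: "\<pi> permutes {1..n}" and p: "p \<in> {1..Suc n}"
  shows "lpk (Suc n) (\<pi> \<circ> slot_cycle (Suc n) p) =
           (if p = Suc n \<or> p \<in> left_peaks n \<pi> \<union> Suc ` left_peaks n \<pi> then lpk n \<pi>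
            else Suc (lpk n \<pi>))"
proof -
  define L where "L = left_peaks n \<pi>"
  have fin [simp]: "finite L" by (simp add: L_def)
  have sub: "L \<subseteq> {1..<n}" by (auto simp: L_def left_peaks_def)
  define A where "A = {i \<in> L. i < p - 1}"
  define B where "B = {i \<in> L. p < i}"
  have [simp]: "finite A" "finite B" by (simp_all add: A_def B_def)
  have "lpk (Suc n) (\<pi> \<circ> slot_cycle (Suc n) p) = card (A \<union> ({p} \<inter> {..n}) \<union> Suc ` B)"
    unfolding lpk_def A_def B_def L_def left_peaks_insert[OF \<pi> p] ..
  also have "\<dots> = card A + card ({p} \<inter> {..n}) + card B"
    by (subst card_Un_disjoint, (auto simp: A_def B_def)[3],
        subst card_Un_disjoint) (auto simp: A_def B_def card_image)
  also have "\<dots> = card (A \<union> B) + card ({p} \<inter> {..n})"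
    by (subst card_Un_disjoint) (auto simp: A_def B_def)
  also have "A \<union> B = L - {p - 1, p}"
    using p by (auto simp: A_def B_def)
  finally have lpk_eq: "lpk (Suc n) (\<pi> \<circ> slot_cycle (Suc n) p) =
    card (L - {p - 1, p}) + card ({p} \<inter> {..n})" .
  consider "p = Suc n" | "p \<le> n" "p \<in> L" | "p \<le> n" "p \<notin> L" "p - 1 \<in> L"
    | "p \<le> n" "p \<notin> L" "p - 1 \<notin> L"
    using p by fastforce
  then have "card (L - {p - 1, p}) + card ({p} \<inter> {..n}) =
           (if p = Suc n \<or> p \<in> L \<union> Suc ` L then card L else Suc (card L))"
  proof cases
    case 1
    then have "L - {p - 1, p} = L" using sub by auto
    then show ?thesis using 1 by simp
  next
    case 2
    then have "p - 1 \<notin> L"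
      using Suc_notin_left_peaks[of "p - 1" n \<pi>] p by (auto simp: L_def)
    then have "L - {p - 1, p} = L - {p}" by auto
    then show ?thesis using 2 card_Suc_Diff1[of L p] by simp
  next
    case 3
    then have "L - {p - 1, p} = L - {p - 1}" "p \<in> Suc ` L"
      using p by (auto simp: image_iff intro!: bexI[of _ "p - 1"])
    then show ?thesis using 3 card_Suc_Diff1[of L "p - 1"] by simp
  next
    case 4
    then have "L - {p - 1, p} = L" "p \<notin> Suc ` L" by auto
    then show ?thesis using 4 by auto
  qed
  then show ?thesis unfolding lpk_eq by (simp only: L_def lpk_def)
qed

lemma sum_insertions:
  fixes x :: "'a::comm_ring_1"
  assumes \<pi>: "\<pi> permutes {1..n}"
  defines "k \<equiv> lpk n \<pi>"
  shows "(\<Sum>p = 1..Suc n. x ^ lpk (Suc n) (\<pi> \<circ> slot_cycle (Suc n) p)) =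
           (2 * of_nat k + 1) * x ^ k + (of_nat n - 2 * of_nat k) * x ^ Suc k"
proof -
  define M where "M = left_peaks n \<pi> \<union> Suc ` left_peaks n \<pi>"
  have M: "M \<subseteq> {1..n}" and card_M: "card M = 2 * k"
    unfolding M_def k_def by (rule left_peaks_Un_Suc_subset, rule card_left_peaks_Un_Suc)
  have fin: "finite M" using M by (rule finite_subset) simp
  \<comment> \<open>Ensures that the natural number \<open>n - 2 * k\<close> is not truncated when
    it is read in the ring.\<close>
  have le: "2 * k \<le> n" using card_mono[OF _ M] card_M by simp
  let ?g = "\<lambda>p. x ^ (if p \<in> M then k else Suc k)"
  have "(\<Sum>p = 1..Suc n. x ^ lpk (Suc n) (\<pi> \<circ> slot_cycle (Suc n) p)) =
        (\<Sum>p = 1..Suc n. x ^ (if p = Suc n \<or> p \<in> M then k else Suc k))"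
    unfolding M_def k_def by (intro sum.cong refl) (simp only: lpk_insert[OF \<pi>])
  also have "\<dots> = (\<Sum>p = 1..n. ?g p) + x ^ k"
    by simp
  also have "(\<Sum>p = 1..n. ?g p) = (\<Sum>p\<in>{1..n} - M. ?g p) + (\<Sum>p\<in>M. ?g p)"
    using M by (intro sum.subset_diff) auto
  also have "\<dots> = of_nat (n - 2 * k) * x ^ Suc k + of_nat (2 * k) * x ^ k"
    using M fin by (simp add: card_Diff_subset card_M)
  also have "\<dots> + x ^ k = (2 * of_nat k + 1) * x ^ k + (of_nat n - 2 * of_nat k) * x ^ Suc k"
    using le by (simp add: of_nat_diff algebra_simps)
  finally show ?thesis .
qed

section \<open>The insertion operator on polynomials\<close>

definition peak_step :: "nat \<Rightarrow> int poly \<Rightarrow> int poly" where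
  "peak_step n f = (1 + of_nat n * [:0, 1:]) * f + 2 * [:0, 1:] * (1 - [:0, 1:]) * pderiv f"

lemma peak_step_add: "peak_step n (f + g) = peak_step n f + peak_step n g"
  unfolding peak_step_def pderiv_add distrib_left by (simp only: add_ac)

lemma peak_step_sum: "peak_step n (sum f A) = (\<Sum>a\<in>A. peak_step n (f a))"
  by (induction A rule: infinite_finite_induct) (simp_all add: peak_step_add, simp_all add: peak_step_def)

lemma peak_step_of_nat_mult: "peak_step n (of_nat c * f) = of_nat c * peak_step n f"
  by (simp add: peak_step_def pderiv_mult pderiv_of_nat algebra_simps)

text \<open>The extra factor \<open>f\<close> restores the exponent \<open>k\<close>, so that
  \<open>k = 0\<close> is covered without a truncated \<open>k - 1\<close>.\<close>

lemma times_pderiv_power: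
  "f * pderiv (f ^ k) = of_nat k * f ^ k * pderiv f" for f :: "int poly"
  by (cases k) (simp_all add: pderiv_power of_nat_poly mult_ac del: power_Suc, simp add: mult_ac)

lemma times_pderiv_X_power: "[:0, 1:] * pderiv ([:0, 1:] ^ k) = of_nat k * ([:0, 1:] :: int poly) ^ k"
  using times_pderiv_power[of "[:0, 1:]" k] by (simp add: pderiv_pCons)

text \<open>The right-hand side is that of \<open>sum_insertions\<close> at
  \<open>x = [:0, 1:]\<close>: on a monomial the operator sums over all insertion slots.\<close>

lemma peak_step_X_power:
  "peak_step n ([:0, 1:] ^ k) =
     (2 * of_nat k + 1) * [:0, 1:] ^ k + (of_nat n - 2 * of_nat k) * [:0, 1:] ^ Suc k"
proof -
  have "peak_step n ([:0, 1:] ^ k) = (1 + of_nat n * [:0, 1:]) * [:0, 1:] ^ k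
          + 2 * (1 - [:0, 1:]) * ([:0, 1:] * pderiv ([:0, 1:] ^ k))"
    unfolding peak_step_def by (simp only: mult_ac)
  then show ?thesis
    unfolding times_pderiv_X_power power_Suc by (simp only: algebra_simps)
qed

text \<open>By the product rule, \<open>x (1 - x) d/dx\<close> multiplies
  \<open>x^j (1 - x)^(m - j)\<close> by \<open>j (1 - x) - (m - j) x = j - m x\<close>.\<close>

lemma peak_step_basis:
  assumes "j \<le> m"
  shows "peak_step n ([:0, 1:] ^ j * (1 - [:0, 1:]) ^ (m - j)) =
           (2 * of_nat j + 1 + (of_nat n - 2 * of_nat m) * [:0, 1:]) *
           ([:0, 1:] ^ j * (1 - [:0, 1:]) ^ (m - j))"
proof -
  define X :: "int poly" where "X = [:0, 1:]"
  define Y where "Y = 1 - X"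
  define d where "d = m - j"
  have m: "m = j + d" using assms by (simp add: d_def)
  have X: "X * pderiv (X ^ j) = of_nat j * X ^ j"
    unfolding X_def by (rule times_pderiv_X_power)
  have "pderiv Y = -1"
    by (simp add: Y_def X_def pderiv_diff pderiv_pCons one_pCons)
  then have Y: "Y * pderiv (Y ^ d) = - (of_nat d * Y ^ d)"
    using times_pderiv_power[of Y d] by simp
  \<comment> \<open>The factor \<open>X * Y\<close> is distributed so that each derivative meets its
    own base.\<close>
  have "peak_step n (X ^ j * Y ^ d) = (1 + of_nat n * X) * (X ^ j * Y ^ d)
      + 2 * (Y * Y ^ d * (X * pderiv (X ^ j)) + X * X ^ j * (Y * pderiv (Y ^ d)))"
    unfolding peak_step_def X_def[symmetric] Y_def[symmetric] pderiv_mult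
    by (simp add: algebra_simps)
  also have "\<dots> = (1 + of_nat n * X + 2 * (of_nat j * Y - of_nat d * X)) * (X ^ j * Y ^ d)"
    unfolding X Y by (simp add: algebra_simps)
  also have "1 + of_nat n * X + 2 * (of_nat j * Y - of_nat d * X) =
      2 * of_nat j + 1 + (of_nat n - 2 * of_nat m) * X"
    by (simp add: Y_def m algebra_simps)
  finally show ?thesis by (simp only: X_def Y_def d_def)
qed

section \<open>Recurrence and expansion with central factorial numbers\<close>

lemma left_peak_poly_0: "left_peak_poly 0 = 1"
  by (simp add: left_peak_poly_def lpk_def left_peaks_def)

lemma left_peak_poly_Suc: "left_peak_poly (Suc n) = peak_step n (left_peak_poly n)"
proof -
  have "left_peak_poly (Suc n) =
      (\<Sum>(\<pi>, p)\<in>{\<pi>. \<pi> permutes {1..n}} \<times> {1..Suc n}. [:0, 1:] ^ lpk (Suc n) (\<pi> \<circ> slot_cycle (Suc n) p))"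
    unfolding left_peak_poly_def
    by (subst sum.reindex_bij_betw[OF permutes_Suc_bij_betw, symmetric])
       (simp add: case_prod_unfold)
  also have "\<dots> = (\<Sum>\<pi> | \<pi> permutes {1..n}. peak_step n ([:0, 1:] ^ lpk n \<pi>))"
    unfolding sum.cartesian_product[symmetric]
    by (intro sum.cong refl) (simp only: mem_Collect_eq sum_insertions peak_step_X_power)
  finally show ?thesis
    by (simp only: left_peak_poly_def peak_step_sum)
qed

lemma central_fact_odd_eq_0: "n < k \<Longrightarrow> central_fact_odd n k = 0"
  by (induction n arbitrary: k) auto

text \<open>For length \<open>2 * n\<close> and \<open>m = n\<close> the term in \<open>x\<close> of
  \<open>peak_step_basis\<close> cancels: each basis polynomial is an eigenvector with eigenvalue
  \<open>2j + 1\<close>, which turns \<open>(2j)!\<close> into \<open>(2j + 1)!\<close>.\<close>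

lemma left_peak_poly_odd_step:
  assumes "left_peak_poly (2 * n) =
    (\<Sum>j = 0..n. of_nat (fact (2 * j) * central_fact_odd n j) * [:0, 1:] ^ j * (1 - [:0, 1:]) ^ (n - j))"
  shows "left_peak_poly (2 * n + 1) =
    (\<Sum>j = 0..n. of_nat (fact (2 * j + 1) * central_fact_odd n j) * [:0, 1:] ^ j * (1 - [:0, 1:]) ^ (n - j))"
proof -
  have "left_peak_poly (2 * n + 1) = (\<Sum>j = 0..n. of_nat (fact (2 * j) * central_fact_odd n j) *
      peak_step (2 * n) ([:0, 1:] ^ j * (1 - [:0, 1:]) ^ (n - j)))"
    using left_peak_poly_Suc[of "2 * n"]
    by (simp only: assms peak_step_sum mult.assoc peak_step_of_nat_mult Suc_eq_plus1)
  also have "\<dots> = (\<Sum>j = 0..n. of_nat (fact (2 * j + 1) * central_fact_odd n j) *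
      ([:0, 1:] ^ j * (1 - [:0, 1:]) ^ (n - j)))"
  proof (intro sum.cong refl)
    fix j assume j: "j \<in> {0..n}"
    have "of_nat (fact (2 * j) * central_fact_odd n j) * (2 * of_nat j + 1) =
        (of_nat (fact (2 * j + 1) * central_fact_odd n j) :: int poly)"
      by (simp add: algebra_simps)
    moreover have "peak_step (2 * n) ([:0, 1:] ^ j * (1 - [:0, 1:]) ^ (n - j)) =
        (2 * of_nat j + 1) * ([:0, 1:] ^ j * (1 - [:0, 1:]) ^ (n - j))"
      using j peak_step_basis[of j n "2 * n"] by simp
    ultimately show "of_nat (fact (2 * j) * central_fact_odd n j) *
        peak_step (2 * n) ([:0, 1:] ^ j * (1 - [:0, 1:]) ^ (n - j)) =
        of_nat (fact (2 * j + 1) * central_fact_odd n j) * ([:0, 1:] ^ j * (1 - [:0, 1:]) ^ (n - j))"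
      by (simp only: mult.assoc[symmetric])
  qed
  finally show ?thesis by (simp only: mult.assoc)
qed

text \<open>Now the length exceeds \<open>2 * n\<close> by one and a term \<open>x\<close> survives.
  Making the factor homogeneous lifts the basis from degree \<open>n\<close> to
  \<open>n + 1\<close>, and the coefficient at \<open>j\<close> collects contributions from
  \<open>j\<close> and \<open>j - 1\<close>.\<close>

lemma left_peak_poly_even_step:
  assumes "left_peak_poly (2 * n + 1) =
    (\<Sum>j = 0..n. of_nat (fact (2 * j + 1) * central_fact_odd n j) * [:0, 1:] ^ j * (1 - [:0, 1:]) ^ (n - j))"
  shows "left_peak_poly (2 * Suc n) =
    (\<Sum>j = 0..Suc n. of_nat (fact (2 * j) * central_fact_odd (Suc n) j) * [:0, 1:] ^ j *
       (1 - [:0, 1:]) ^ (Suc n - j))"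
proof -
  define X :: "int poly" where "X = [:0, 1:]"
  define E where "E j = X ^ j * (1 - X) ^ (Suc n - j)" for j
  define a where "a j = fact (2 * j + 1) * central_fact_odd n j" for j
  have step: "peak_step (2 * n + 1) (X ^ j * (1 - X) ^ (n - j)) =
      of_nat (2 * j + 1) * E j + of_nat (2 * j + 2) * E (Suc j)" if "j \<le> n" for j
  proof -
    have "peak_step (2 * n + 1) (X ^ j * (1 - X) ^ (n - j)) =
        (2 * of_nat j + 1 + X) * (X ^ j * (1 - X) ^ (n - j))"
      using peak_step_basis[OF that, of "2 * n + 1"] by (simp add: X_def)
    also have "\<dots> = ((2 * of_nat j + 1) * (1 - X) + (2 * of_nat j + 2) * X) * (X ^ j * (1 - X) ^ (n - j))"
      by (simp add: algebra_simps)
    also have "\<dots> = of_nat (2 * j + 1) * E j + of_nat (2 * j + 2) * E (Suc j)"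
      using that by (simp add: E_def Suc_diff_le algebra_simps)
    finally show ?thesis .
  qed
  \<comment> \<open>The first term uses \<open>(2j + 2) (2j + 1)! = (2j + 2)!\<close>. In the
    second, the factor \<open>2j + 3\<close> joins the one inside \<open>(2j + 3)!\<close> to form
    the square in the recurrence of \<open>V\<close>.\<close>
  have coeff: "fact (2 * Suc j) * central_fact_odd (Suc n) (Suc j) =
      (2 * j + 2) * a j + (2 * Suc j + 1) * a (Suc j)" for j
    by (simp add: a_def power2_eq_square algebra_simps)
  have "left_peak_poly (2 * Suc n) =
      (\<Sum>j = 0..n. of_nat (a j) * peak_step (2 * n + 1) (X ^ j * (1 - X) ^ (n - j)))"
    using left_peak_poly_Suc[of "2 * n + 1"] unfolding a_def X_def
    by (simp only: assms peak_step_sum mult.assoc peak_step_of_nat_mult) simp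
  also have "\<dots> = (\<Sum>j = 0..n. of_nat ((2 * j + 1) * a j) * E j) +
      (\<Sum>j = 0..n. of_nat ((2 * j + 2) * a j) * E (Suc j))"
    unfolding sum.distrib[symmetric]
  proof (intro sum.cong refl)
    fix j assume "j \<in> {0..n}"
    then have "j \<le> n" by simp
    show "of_nat (a j) * peak_step (2 * n + 1) (X ^ j * (1 - X) ^ (n - j)) =
        of_nat ((2 * j + 1) * a j) * E j + of_nat ((2 * j + 2) * a j) * E (Suc j)"
      unfolding step[OF \<open>j \<le> n\<close>] of_nat_mult distrib_left by (simp only: mult_ac)
  qed
  \<comment> \<open>The added term vanishes because \<open>V(n, n + 1) = 0\<close>; after the index
    shift both sums then have the same range.\<close>
  also have "(\<Sum>j = 0..n. of_nat ((2 * j + 1) * a j) * E j) =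
      (\<Sum>j = 0..Suc n. of_nat ((2 * j + 1) * a j) * E j)"
    by (simp add: a_def central_fact_odd_eq_0)
  also have "\<dots> = of_nat (a 0) * E 0 + (\<Sum>j = 0..n. of_nat ((2 * Suc j + 1) * a (Suc j)) * E (Suc j))"
    by (subst sum.atLeast0_atMost_Suc_shift) (simp only: o_def mult_0_right add_0 mult_1)
  also have "\<dots> + (\<Sum>j = 0..n. of_nat ((2 * j + 2) * a j) * E (Suc j)) =
      of_nat (a 0) * E 0 + (\<Sum>j = 0..n. of_nat ((2 * j + 2) * a j + (2 * Suc j + 1) * a (Suc j)) * E (Suc j))"
    unfolding sum.distrib[symmetric] add.assoc of_nat_add distrib_right by (simp only: add_ac)
  \<comment> \<open>At index 0 the recurrence has only its square term, with factor 1, so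
    \<open>V(n + 1, 0) = V(n, 0)\<close>.\<close>
  also have "\<dots> = of_nat (fact (2 * 0) * central_fact_odd (Suc n) 0) * E 0 +
      (\<Sum>j = 0..n. of_nat (fact (2 * Suc j) * central_fact_odd (Suc n) (Suc j)) * E (Suc j))"
    unfolding coeff by (simp add: a_def)
  also have "\<dots> = (\<Sum>j = 0..Suc n. of_nat (fact (2 * j) * central_fact_odd (Suc n) j) * E j)"
    by (simp only: sum.atLeast0_atMost_Suc_shift o_def)
  finally show ?thesis by (simp only: E_def X_def mult.assoc)
qed

theorem theorem4:
  fixes n :: nat
  assumes "n \<ge> 1"
  shows "left_peak_poly (2 * n) =
           (\<Sum>j = 0..n. of_nat (fact (2 * j) * central_fact_odd n j) * [:0, 1:] ^ j * (1 - [:0, 1:]) ^ (n - j))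
       \<and> left_peak_poly (2 * n + 1) =
           (\<Sum>j = 0..n. of_nat (fact (2 * j + 1) * central_fact_odd n j) * [:0, 1:] ^ j * (1 - [:0, 1:]) ^ (n - j))"
proof -
  \<comment> \<open>The induction passes from \<open>2n\<close> through \<open>2n + 1\<close> to
    \<open>2n + 2\<close>, starting at the empty permutation.\<close>
  have "left_peak_poly (2 * n) =
      (\<Sum>j = 0..n. of_nat (fact (2 * j) * central_fact_odd n j) * [:0, 1:] ^ j * (1 - [:0, 1:]) ^ (n - j))"
  proof (induction n)
    case 0
    show ?case by (simp add: left_peak_poly_0)
  next
    case (Suc n)
    then show ?case by (intro left_peak_poly_even_step left_peak_poly_odd_step)
  qed
  then show ?thesis by (blast intro: left_peak_poly_odd_step)
qed

end
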